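(* Let $R\subset S$ be an integral distributive FCP extension. Then, for each $M\in\mathrm{Spec}(R)$, the fiber at $M$ of $R\subset S$, i.e. the set of prime ideals $Q$ of $S$ with $Q\cap R=M$, has at most two elements.
   Context: All rings are commutative with unit. $[R,S]$ denotes the set of all $R$-subalgebras of $S$, ordered by inclusion; it is a lattice in which the infimum of $T,U$ is $T\cap U$ and the supremum is the compositum $TU$. The extension $R\subseteq S$ is called distributive if the lattice $[R,S]$ is distributive. It has FCP if every chain in $[R,S]$ is finite. *)

theory Defs
  imports "HOL-Algebra.Algebra"
begin

text \<open>
  A ring extension is a commutative ring \<open>S\<close> together with a subring \<open>R\<close> of \<open>S\<close>, given as a subset
  of \<open>carrier S\<close>; as a ring of its own, \<open>R\<close> is \<open>S\<lparr>carrier := R\<rparr>\<close>.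
\<close>

definition subalgebras :: "'a set \<Rightarrow> ('a, 'b) ring_scheme \<Rightarrow> 'a set set" where
  "subalgebras R S = {T. subring T S \<and> R \<subseteq> T}"

definition subalgebra_order :: "'a set \<Rightarrow> ('a, 'b) ring_scheme \<Rightarrow> 'a set gorder" where
  "subalgebra_order R S = \<lparr>carrier = subalgebras R S, eq = (=), le = (\<subseteq>)\<rparr>"

definition distributive_lattice :: "('a, 'b) gorder_scheme \<Rightarrow> bool" where
  "distributive_lattice L \<longleftrightarrow> lattice L \<and>
     (\<forall>x\<in>carrier L. \<forall>y\<in>carrier L. \<forall>z\<in>carrier L.
        x \<sqinter>\<^bsub>L\<^esub> (y \<squnion>\<^bsub>L\<^esub> z) = (x \<sqinter>\<^bsub>L\<^esub> y) \<squnion>\<^bsub>L\<^esub> (x \<sqinter>\<^bsub>L\<^esub> z))"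

definition distributive_extension :: "'a set \<Rightarrow> ('a, 'b) ring_scheme \<Rightarrow> bool" where
  "distributive_extension R S \<longleftrightarrow> distributive_lattice (subalgebra_order R S)"

definition FCP_extension :: "'a set \<Rightarrow> ('a, 'b) ring_scheme \<Rightarrow> bool" where
  "FCP_extension R S \<longleftrightarrow> (\<forall>C. subset.chain (subalgebras R S) C \<longrightarrow> finite C)"

text \<open>
  Polynomials are coefficient lists, leading coefficient first. The library's predicate
  \<open>polynomial\<close> is not used because it excludes monic polynomials over the zero ring.
\<close>

definition integral_over :: "'a set \<Rightarrow> ('a, 'b) ring_scheme \<Rightarrow> 'a \<Rightarrow> bool" where
  "integral_over R S x \<longleftrightarrow>
     (\<exists>p. p \<noteq> [] \<and> set p \<subseteq> R \<and> lead_coeff p = \<one>\<^bsub>S\<^esub> \<and> ring.eval S p x = \<zero>\<^bsub>S\<^esub>)"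

definition integral_extension :: "'a set \<Rightarrow> ('a, 'b) ring_scheme \<Rightarrow> bool" where
  "integral_extension R S \<longleftrightarrow> (\<forall>x\<in>carrier S. integral_over R S x)"

definition Spec :: "('a, 'b) ring_scheme \<Rightarrow> 'a set set" where
  "Spec A = {P. primeideal P A}"

definition fiber :: "'a set \<Rightarrow> ('a, 'b) ring_scheme \<Rightarrow> 'a set \<Rightarrow> 'a set set" where
  "fiber R S M = {Q \<in> Spec S. Q \<inter> R = M}"

text \<open>The infimum in the order of subalgebras is the intersection, the supremum the compositum.\<close>

context ring
begin

lemma generate_ring_subalgebra:
  assumes "T \<in> subalgebras K R" "U \<in> subalgebras K R"
  shows "generate_ring R (T \<union> U) \<in> subalgebras K R"
proof -
  have "T \<union> U \<subseteq> carrier R"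
    using assms by (auto simp: subalgebras_def dest: subringE(1))
  then have "subring (generate_ring R (T \<union> U)) R"
    by (rule generate_ring_is_subring)
  moreover have "K \<subseteq> generate_ring R (T \<union> U)"
    using assms by (auto simp: subalgebras_def intro: generate_ring.incl)
  ultimately show ?thesis
    by (simp add: subalgebras_def)
qed

lemma inter_subalgebra:
  assumes "T \<in> subalgebras K R" "U \<in> subalgebras K R"
  shows "T \<inter> U \<in> subalgebras K R"
  using assms by (auto simp: subalgebras_def subring_inter)

lemma partial_order_subalgebra: "partial_order (subalgebra_order K R)"
  by unfold_locales (auto simp: subalgebra_order_def)

lemma least_subalgebra:
  assumes "T \<in> subalgebras K R" "U \<in> subalgebras K R"
  shows "least (subalgebra_order K R) (generate_ring R (T \<union> U))
           (Upper (subalgebra_order K R) {T, U})"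
proof -
  have TU: "T \<union> U \<subseteq> carrier R"
    using assms by (auto simp: subalgebras_def dest: subringE(1))
  have min: "generate_ring R (T \<union> U) \<subseteq> V" if "V \<in> subalgebras K R" "T \<subseteq> V" "U \<subseteq> V" for V
    using that generate_ring_min_subring1[OF TU, of V] by (simp add: subalgebras_def)
  have "T \<subseteq> generate_ring R (T \<union> U)" "U \<subseteq> generate_ring R (T \<union> U)"
    by (auto intro: generate_ring.incl)
  with min generate_ring_subalgebra[OF assms] assms show ?thesis
    unfolding least_def Upper_def subalgebra_order_def by simp
qed

lemma greatest_subalgebra:
  assumes "T \<in> subalgebras K R" "U \<in> subalgebras K R"
  shows "greatest (subalgebra_order K R) (T \<inter> U) (Lower (subalgebra_order K R) {T, U})"
  using inter_subalgebra[OF assms] assms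
  by (simp add: greatest_def Lower_def subalgebra_order_def)

lemma lattice_subalgebra: "lattice (subalgebra_order K R)"
proof -
  interpret P: partial_order "subalgebra_order K R" by (rule partial_order_subalgebra)
  show ?thesis
  proof
    fix T U assume "T \<in> carrier (subalgebra_order K R)" "U \<in> carrier (subalgebra_order K R)"
    then have TU: "T \<in> subalgebras K R" "U \<in> subalgebras K R"
      by (auto simp: subalgebra_order_def)
    show "\<exists>s. least (subalgebra_order K R) s (Upper (subalgebra_order K R) {T, U})"
      using least_subalgebra[OF TU] by blast
    show "\<exists>s. greatest (subalgebra_order K R) s (Lower (subalgebra_order K R) {T, U})"
      using greatest_subalgebra[OF TU] by blast
  qed
qed

lemma join_subalgebra:
  assumes "T \<in> subalgebras K R" "U \<in> subalgebras K R"
  shows "T \<squnion>\<^bsub>subalgebra_order K R\<^esub> U = generate_ring R (T \<union> U)"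
proof -
  interpret P: partial_order "subalgebra_order K R" by (rule partial_order_subalgebra)
  show ?thesis
    unfolding join_def sup_def
    using least_subalgebra[OF assms] by (rule some_equality) (rule P.least_unique[OF _ least_subalgebra[OF assms]])
qed

lemma meet_subalgebra:
  assumes "T \<in> subalgebras K R" "U \<in> subalgebras K R"
  shows "T \<sqinter>\<^bsub>subalgebra_order K R\<^esub> U = T \<inter> U"
proof -
  interpret P: partial_order "subalgebra_order K R" by (rule partial_order_subalgebra)
  show ?thesis
    unfolding meet_def inf_def
    using greatest_subalgebra[OF assms] by (rule some_equality) (rule P.greatest_unique[OF _ greatest_subalgebra[OF assms]])
qed

lemma distributive_extension_iff:
  "distributive_extension K R \<longleftrightarrow>
     (\<forall>T\<in>subalgebras K R. \<forall>U\<in>subalgebras K R. \<forall>V\<in>subalgebras K R.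
        T \<inter> generate_ring R (U \<union> V) = generate_ring R ((T \<inter> U) \<union> (T \<inter> V)))"
proof -
  have "carrier (subalgebra_order K R) = subalgebras K R"
    by (simp add: subalgebra_order_def)
  then show ?thesis
    by (simp add: distributive_extension_def distributive_lattice_def lattice_subalgebra
        join_subalgebra meet_subalgebra inter_subalgebra generate_ring_subalgebra)
qed

end

end

theory Submission
  imports Defs
begin

text \<open>
  Suppose that three distinct primes \<open>Q1, Q2, Q3\<close> of the ring lie over the same \<open>M\<close>. Modulo the
  primes, the diagonals \<open>x\<^sub>i = x\<^sub>j\<close> behave like the three middle elements of the
  partition lattice of a three-element set, which is not distributive. Accordingly, with \<open>K\<close> the
  base ring, let \<open>T\<^sub>i\<^sub>j = K + (Q\<^sub>i \<inter> Q\<^sub>j)\<close>. Any two of these subalgebras meet in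
  \<open>D = K + (Q1 \<inter> Q2 \<inter> Q3)\<close> (lemma \<open>set_add_inter_subset\<close>), so distributivity
  forces the intersection of \<open>T\<^sub>1\<^sub>2\<close> with the compositum of \<open>T\<^sub>1\<^sub>3\<close> and
  \<open>T\<^sub>2\<^sub>3\<close> into \<open>D\<close>. An element of \<open>D\<close> that lies in \<open>Q1\<close> also lies in
  \<open>Q3\<close>, because its part in \<open>K\<close> then lies in \<open>M\<close>. It therefore suffices to find a product of
  an element of \<open>T\<^sub>1\<^sub>3\<close> and an element of \<open>T\<^sub>2\<^sub>3\<close> that lies in \<open>Q1\<close> and
  in \<open>Q2\<close> but not in \<open>Q3\<close>.

  If \<open>M\<close> were maximal, the Chinese remainder theorem would supply such factors. In general
  integrality does (lemma \<open>integral_ideal_meets_coset\<close>): an ideal not contained in a prime \<open>Q\<close>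
  contains, up to an error in \<open>Q\<close>, an element of \<open>K\<close> outside \<open>Q\<close>. Applied to the ideal
  \<open>Q1 \<inter> Q3\<close> and the prime \<open>Q2\<close> it gives \<open>w \<in> Q1 \<inter> Q3\<close> and \<open>r \<in> K - M\<close> with
  \<open>w + r \<in> Q2\<close>; this sum is in \<open>T\<^sub>1\<^sub>3\<close> and, since \<open>r \<notin> Q3\<close>, outside \<open>Q3\<close>. The
  other factor arises by exchanging \<open>Q1\<close> and \<open>Q2\<close>. The same lemma shows that distinct primes of
  a fiber are incomparable, which is what makes the ideals \<open>Q1 \<inter> Q3\<close> and \<open>Q2 \<inter> Q3\<close>
  eligible.
\<close>

context cring
begin

lemma ideal_add_mem_iff:
  assumes "ideal I R" "a \<in> I" "b \<in> carrier R"
  shows "a \<oplus> b \<in> I \<longleftrightarrow> b \<in> I"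
proof
  interpret ideal I R by fact
  have a: "a \<in> carrier R" using assms(2) by (rule a_Hcarr)
  assume "a \<oplus> b \<in> I"
  then have "\<ominus> a \<oplus> (a \<oplus> b) \<in> I"
    using assms(2) by (blast intro: additive_subgroup.a_closed additive_subgroup.a_inv_closed is_additive_subgroup)
  then show "b \<in> I" using a assms(3) by (simp add: r_neg1)
next
  interpret ideal I R by fact
  assume "b \<in> I"
  then show "a \<oplus> b \<in> I" using assms(2) by (blast intro: additive_subgroup.a_closed is_additive_subgroup)
qed

lemma subring_set_add_ideal:
  assumes K: "subring K R" and I: "ideal I R"
  shows "subring (K <+>\<^bsub>R\<^esub> I) R"
proof -
  interpret I: ideal I R by fact
  note K_in = subringE[OF K]
  have Kc: "k \<in> carrier R" if "k \<in> K" for k using that K_in(1) by blast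
  show ?thesis
  proof (rule subringI)
    show "K <+>\<^bsub>R\<^esub> I \<subseteq> carrier R"
      using Kc I.a_Hcarr by (auto simp: set_add_def')
    have "\<one> = \<one> \<oplus> \<zero>" by simp
    then show "\<one> \<in> K <+>\<^bsub>R\<^esub> I"
      using K_in(3) I.zero_closed unfolding set_add_def' by blast
  next
    fix x assume "x \<in> K <+>\<^bsub>R\<^esub> I"
    then obtain k i where "k \<in> K" "i \<in> I" "x = k \<oplus> i" by (auto simp: set_add_def')
    moreover from this have "\<ominus> x = \<ominus> k \<oplus> \<ominus> i" using Kc I.a_Hcarr by (simp add: minus_add)
    ultimately show "\<ominus> x \<in> K <+>\<^bsub>R\<^esub> I"
      using K_in(5) I.a_inv_closed unfolding set_add_def' by blast
  next
    fix x y assume "x \<in> K <+>\<^bsub>R\<^esub> I" "y \<in> K <+>\<^bsub>R\<^esub> I"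
    then obtain k i l j where *: "k \<in> K" "i \<in> I" "x = k \<oplus> i" "l \<in> K" "j \<in> I" "y = l \<oplus> j"
      by (auto simp: set_add_def')
    note c = Kc[OF *(1)] Kc[OF *(4)] I.a_Hcarr[OF *(2)] I.a_Hcarr[OF *(5)]
    have "x \<oplus> y = (k \<oplus> l) \<oplus> (i \<oplus> j)" using c unfolding * by algebra
    then show "x \<oplus> y \<in> K <+>\<^bsub>R\<^esub> I"
      using K_in(7)[OF *(1) *(4)] I.a_closed[OF *(2) *(5)] unfolding set_add_def' by blast
    have "x \<otimes> y = (k \<otimes> l) \<oplus> (k \<otimes> j \<oplus> i \<otimes> y)" using c unfolding * by algebra
    moreover have "k \<otimes> j \<oplus> i \<otimes> y \<in> I"
      using c * by (intro I.a_closed I.I_l_closed I.I_r_closed) auto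
    ultimately show "x \<otimes> y \<in> K <+>\<^bsub>R\<^esub> I"
      using K_in(6)[OF *(1) *(4)] unfolding set_add_def' by blast
  qed
qed

lemma set_add_ideal_mem_subalgebras:
  assumes "subring K R" "ideal I R"
  shows "K <+>\<^bsub>R\<^esub> I \<in> subalgebras K R"
proof -
  interpret I: ideal I R by fact
  have "k \<in> K <+>\<^bsub>R\<^esub> I" if "k \<in> K" for k
  proof -
    have "k = k \<oplus> \<zero>" using that subringE(1)[OF assms(1)] by auto
    then show ?thesis using that I.zero_closed unfolding set_add_def' by blast
  qed
  then show ?thesis
    using subring_set_add_ideal[OF assms] by (auto simp: subalgebras_def)
qed

text \<open>
  Take a monic equation for some \<open>u \<in> I - Q\<close>, read modulo \<open>Q\<close>. As long as its constant term is
  in \<open>Q\<close>, a factor \<open>u\<close> can be cancelled, because \<open>Q\<close> is prime. This stops before the leading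
  coefficient is reached, and the equation then says that a constant term outside \<open>Q\<close> is minus
  a multiple of \<open>u\<close> modulo \<open>Q\<close>.
\<close>

lemma integral_ideal_meets_coset:
  assumes K: "subring K R" and Q: "primeideal Q R" and I: "ideal I R"
    and u: "u \<in> I" "u \<notin> Q" and int: "integral_over K R u"
  obtains w r where "w \<in> I" "r \<in> K" "r \<notin> Q" "w \<oplus> r \<in> Q"
proof -
  interpret Q: primeideal Q R by fact
  interpret I: ideal I R by fact
  note uc = I.a_Hcarr[OF u(1)]
  \<comment> \<open>Equality with zero is relaxed to membership in \<open>Q\<close> so that cancelling \<open>u\<close> preserves it.\<close>
  have "\<exists>w\<in>I. \<exists>r\<in>K. r \<notin> Q \<and> w \<oplus> r \<in> Q"
    if "p \<noteq> []" "set p \<subseteq> K" "lead_coeff p = \<one>" "eval p u \<in> Q" for p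
    using that
  proof (induction p rule: rev_induct)
    case (snoc c p)
    have pc: "set p \<subseteq> carrier R" and cK: "c \<in> K" "c \<in> carrier R"
      using snoc.prems(2) subringE(1)[OF K] by auto
    let ?e = "eval p u"
    have ec: "?e \<in> carrier R" using pc uc by (rule eval_in_carrier)
    have eval: "?e \<otimes> u \<oplus> c \<in> Q"
      using snoc.prems(4) eval_append_aux[OF pc cK(2) uc] by simp
    show ?case
    proof (cases "c \<in> Q")
      case False
      then show ?thesis using eval cK I.I_l_closed[OF u(1) ec] by blast
    next
      case True
      have "c \<oplus> ?e \<otimes> u \<in> Q" using eval ec uc cK by (simp add: a_comm)
      then have "?e \<otimes> u \<in> Q"
        using ideal_add_mem_iff[OF Q.is_ideal True] ec uc by simp
      then have "?e \<in> Q" using Q.I_prime[OF ec uc] u(2) by blast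
      \<comment> \<open>Otherwise the constant term is the leading coefficient, and \<open>Q\<close> contains \<open>\<one>\<close>.\<close>
      moreover have "p \<noteq> []"
      proof
        assume "p = []"
        then have "\<one> \<in> Q" using True snoc.prems(3) by simp
        then show False using Q.one_imp_carrier Q.I_notcarr by simp
      qed
      ultimately show ?thesis using snoc by simp
    qed
  qed simp
  then show thesis
    using int that Q.zero_closed unfolding integral_over_def by metis
qed

text \<open>
  If \<open>P\<close> were strictly smaller, the ideal \<open>Q\<close> would contain an element \<open>r\<close> of \<open>K\<close> outside
  \<open>P\<close>: the error of the approximation is in \<open>P\<close> and hence in \<open>Q\<close>.
\<close>

lemma integral_incomparable:
  assumes K: "subring K R" and int: "integral_extension K R"
    and P: "primeideal P R" and Q: "primeideal Q R"
    and eq: "P \<inter> K = Q \<inter> K" and le: "P \<subseteq> Q"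
  shows "P = Q"
proof (rule ccontr)
  interpret P: primeideal P R by fact
  interpret Q: primeideal Q R by fact
  assume "P \<noteq> Q"
  with le obtain u where u: "u \<in> Q" "u \<notin> P" by blast
  have "integral_over K R u"
    using int Q.a_Hcarr[OF u(1)] by (simp add: integral_extension_def)
  then obtain w r where w: "w \<in> Q" "r \<in> K" "r \<notin> P" "w \<oplus> r \<in> P"
    by (rule integral_ideal_meets_coset[OF K P Q.is_ideal u])
  then have "r \<in> Q"
    using ideal_add_mem_iff[OF Q.is_ideal w(1)] le subringE(1)[OF K] by blast
  then show False using w eq by blast
qed

lemma inter_not_subset_prime:
  assumes "ideal I R" "ideal J R" "primeideal Q R" "\<not> I \<subseteq> Q" "\<not> J \<subseteq> Q"
  shows "\<not> I \<inter> J \<subseteq> Q"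
proof -
  interpret I: ideal I R by fact
  interpret J: ideal J R by fact
  interpret Q: primeideal Q R by fact
  obtain x y where xy: "x \<in> I" "x \<notin> Q" "y \<in> J" "y \<notin> Q" using assms by blast
  note c = I.a_Hcarr[OF xy(1)] J.a_Hcarr[OF xy(3)]
  have "x \<otimes> y \<in> I \<inter> J" using xy c by (blast intro: I.I_r_closed J.I_l_closed)
  moreover have "x \<otimes> y \<notin> Q" using Q.I_prime[OF c] xy by blast
  ultimately show ?thesis by blast
qed

text \<open>
  Two decompositions \<open>k + i = l + j\<close> of one element differ by \<open>l - k = i - j\<close>, an element of
  \<open>I \<inter> K\<close>. The hypothesis puts this into \<open>L\<close>, and so \<open>i\<close> is in \<open>L\<close> along with \<open>j\<close>.
\<close>

lemma set_add_inter_subset: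
  assumes K: "subring K R" and I: "ideal I R" and J: "ideal J R" and L: "ideal L R"
    and le: "I \<inter> K \<subseteq> L"
  shows "(K <+>\<^bsub>R\<^esub> (I \<inter> J)) \<inter> (K <+>\<^bsub>R\<^esub> (I \<inter> L)) \<subseteq> K <+>\<^bsub>R\<^esub> (I \<inter> J \<inter> L)"
proof
  interpret I: ideal I R by fact
  interpret L: ideal L R by fact
  fix x assume "x \<in> (K <+>\<^bsub>R\<^esub> (I \<inter> J)) \<inter> (K <+>\<^bsub>R\<^esub> (I \<inter> L))"
  then obtain k i l j where *: "k \<in> K" "i \<in> I" "i \<in> J" "x = k \<oplus> i"
      "l \<in> K" "j \<in> I" "j \<in> L" "x = l \<oplus> j"
    by (auto simp: set_add_def')
  have c: "k \<in> carrier R" "l \<in> carrier R" "i \<in> carrier R" "j \<in> carrier R"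
    using * subringE(1)[OF K] I.a_Hcarr by auto
  have xx: "k \<oplus> i = l \<oplus> j" using * by simp
  have "l \<oplus> \<ominus> k = i \<oplus> \<ominus> j"
  proof -
    have "l \<oplus> \<ominus> k = (l \<oplus> j) \<oplus> \<ominus> j \<oplus> \<ominus> k" using c by algebra
    also have "\<dots> = i \<oplus> \<ominus> j" unfolding xx[symmetric] using c by algebra
    finally show ?thesis .
  qed
  moreover have "i \<oplus> \<ominus> j \<in> I" using * by (intro I.a_closed I.a_inv_closed)
  moreover have "l \<oplus> \<ominus> k \<in> K" using * subringE(5,7)[OF K] by blast
  ultimately have "i \<oplus> \<ominus> j \<in> L" using le by auto
  then have "(i \<oplus> \<ominus> j) \<oplus> j \<in> L" using * by (blast intro: L.a_closed)
  moreover have "(i \<oplus> \<ominus> j) \<oplus> j = i" using c by algebra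
  ultimately have "i \<in> L" by simp
  then show "x \<in> K <+>\<^bsub>R\<^esub> (I \<inter> J \<inter> L)"
    using * unfolding set_add_def' by blast
qed

lemma no_three_primes_in_fiber:
  assumes K: "subring K R" and int: "integral_extension K R"
    and dist: "distributive_extension K R"
    and Q: "Q1 \<in> fiber K R M" "Q2 \<in> fiber K R M" "Q3 \<in> fiber K R M"
    and ne: "Q1 \<noteq> Q2" "Q1 \<noteq> Q3" "Q2 \<noteq> Q3"
  shows False
proof -
  have prime: "primeideal Q1 R" "primeideal Q2 R" "primeideal Q3 R"
    and over: "Q1 \<inter> K = M" "Q2 \<inter> K = M" "Q3 \<inter> K = M"
    using Q by (auto simp: fiber_def Spec_def)
  interpret Q1: primeideal Q1 R by fact
  interpret Q2: primeideal Q2 R by fact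
  interpret Q3: primeideal Q3 R by fact
  have id: "ideal Q1 R" "ideal Q2 R" "ideal Q3 R" by (rule primeideal.axioms(1), fact)+
  have id2: "ideal (Q1 \<inter> Q2) R" "ideal (Q1 \<inter> Q3) R" "ideal (Q2 \<inter> Q3) R"
    using id by (simp_all add: i_intersect)
  have Kc: "k \<in> carrier R" if "k \<in> K" for k using that subringE(1)[OF K] by blast

  have incomp: "\<not> P \<subseteq> P'" if "P \<in> {Q1, Q2, Q3}" "P' \<in> {Q1, Q2, Q3}" "P \<noteq> P'" for P P'
    using integral_incomparable[OF K int, of P P'] prime over that by auto
  have approx: "\<exists>w r. w \<in> I \<and> r \<in> K \<and> r \<notin> P \<and> w \<oplus> r \<in> P"
    if I: "ideal I R" and P: "primeideal P R" and not_sub: "\<not> I \<subseteq> P" for I P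
  proof -
    obtain u where u: "u \<in> I" "u \<notin> P" using not_sub by blast
    have "integral_over K R u"
      using int ideal.Icarr[OF I u(1)] by (simp add: integral_extension_def)
    then show ?thesis by (rule integral_ideal_meets_coset[OF K P I u]) blast
  qed
  have "\<not> Q1 \<inter> Q3 \<subseteq> Q2" "\<not> Q2 \<inter> Q3 \<subseteq> Q1"
    by (rule inter_not_subset_prime[OF id(1,3) prime(2)] inter_not_subset_prime[OF id(2,3) prime(1)];
        rule incomp; use ne in simp)+
  from approx[OF id2(2) prime(2) this(1)] approx[OF id2(3) prime(1) this(2)]
  obtain w r w' r' where
    w: "w \<in> Q1" "w \<in> Q3" "r \<in> K" "r \<notin> Q2" "w \<oplus> r \<in> Q2" and
    w': "w' \<in> Q2" "w' \<in> Q3" "r' \<in> K" "r' \<notin> Q1" "w' \<oplus> r' \<in> Q1"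
    by blast
  note c = Kc[OF w(3)] Kc[OF w'(3)] Q3.a_Hcarr[OF w(2)] Q3.a_Hcarr[OF w'(2)]
  let ?x = "(w \<oplus> r) \<otimes> (w' \<oplus> r')"
  let ?T12 = "K <+>\<^bsub>R\<^esub> (Q1 \<inter> Q2)"
    and ?T13 = "K <+>\<^bsub>R\<^esub> (Q1 \<inter> Q3)"
    and ?T23 = "K <+>\<^bsub>R\<^esub> (Q2 \<inter> Q3)"
  have x12: "?x \<in> Q1" "?x \<in> Q2"
    using Q1.I_l_closed[OF w'(5), of "w \<oplus> r"] Q2.I_r_closed[OF w(5), of "w' \<oplus> r'"] c
    by simp_all
  have "r \<notin> Q3" "r' \<notin> Q3" using w w' over by auto
  then have "w \<oplus> r \<notin> Q3" "w' \<oplus> r' \<notin> Q3"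
    using ideal_add_mem_iff[OF id(3)] w w' c by simp_all
  then have x3: "?x \<notin> Q3" using Q3.I_prime[of "w \<oplus> r" "w' \<oplus> r'"] c by auto

  have sub: "?T12 \<in> subalgebras K R" "?T13 \<in> subalgebras K R" "?T23 \<in> subalgebras K R"
    using K id2 by (auto intro: set_add_ideal_mem_subalgebras)
  have "w \<oplus> r = r \<oplus> w" "w' \<oplus> r' = r' \<oplus> w'" using c by (simp_all add: a_comm)
  then have "w \<oplus> r \<in> ?T13" "w' \<oplus> r' \<in> ?T23"
    using w w' unfolding set_add_def' by blast+
  then have "?x \<in> generate_ring R (?T13 \<union> ?T23)"
    by (blast intro: generate_ring.incl generate_ring.eng_mult)
  moreover have "?x \<in> ?T12"
  proof -
    have "?x = \<zero> \<oplus> ?x" using c by simp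
    then show ?thesis using x12 subringE(2)[OF K] unfolding set_add_def' by blast
  qed
  ultimately have "?x \<in> generate_ring R ((?T12 \<inter> ?T13) \<union> (?T12 \<inter> ?T23))"
    using dist sub unfolding distributive_extension_iff by blast
  also have "\<dots> \<subseteq> K <+>\<^bsub>R\<^esub> (Q1 \<inter> Q2 \<inter> Q3)"
  proof (rule generate_ring_min_subring1)
    show "?T12 \<inter> ?T13 \<union> ?T12 \<inter> ?T23 \<subseteq> carrier R"
      using sub by (auto simp: subalgebras_def dest: subringE(1))
    show "subring (K <+>\<^bsub>R\<^esub> (Q1 \<inter> Q2 \<inter> Q3)) R"
      using K id2 id by (intro subring_set_add_ideal i_intersect)
    show "?T12 \<inter> ?T13 \<union> ?T12 \<inter> ?T23 \<subseteq> K <+>\<^bsub>R\<^esub> (Q1 \<inter> Q2 \<inter> Q3)"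
    proof (rule Un_least)
      show "?T12 \<inter> ?T13 \<subseteq> K <+>\<^bsub>R\<^esub> (Q1 \<inter> Q2 \<inter> Q3)"
        using over by (intro set_add_inter_subset[OF K id]) blast
      show "?T12 \<inter> ?T23 \<subseteq> K <+>\<^bsub>R\<^esub> (Q1 \<inter> Q2 \<inter> Q3)"
        using over
        by (intro set_add_inter_subset[OF K id(2,1,3), unfolded Int_commute[of Q2 Q1]]) blast
    qed
  qed
  finally obtain k q where kq: "k \<in> K" "q \<in> Q1" "q \<in> Q3" "?x = k \<oplus> q"
    by (auto simp: set_add_def')
  have kq': "?x = q \<oplus> k" using kq Kc Q1.a_Hcarr by (simp add: a_comm)
  have "k \<in> Q1" using x12(1) ideal_add_mem_iff[OF id(1) kq(2)] kq' Kc[OF kq(1)] by simp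
  then have "k \<in> Q3" using kq over by blast
  then have "?x \<in> Q3" unfolding kq' using kq(3) by (intro Q3.a_closed)
  with x3 show False by contradiction
qed

end

theorem proposition7p1:
  fixes S :: "('a, 'b) ring_scheme" and R :: "'a set"
  assumes "cring S"
    and "subring R S"
    and "R \<noteq> carrier S"
    and "integral_extension R S"
    and "distributive_extension R S"
    and "FCP_extension R S"
  shows "\<forall>M \<in> Spec (S\<lparr>carrier := R\<rparr>). finite (fiber R S M) \<and> card (fiber R S M) \<le> 2"
proof
  fix M
  interpret cring S by fact
  show "finite (fiber R S M) \<and> card (fiber R S M) \<le> 2"
  proof (rule ccontr)
    assume "\<not> ?thesis"
    then have "infinite (fiber R S M) \<or> 3 \<le> card (fiber R S M)" by auto
    then have "\<exists>F \<subseteq> fiber R S M. card F = 3"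
      by (meson infinite_arbitrarily_large obtain_subset_with_card_n)
    then obtain F where F: "F \<subseteq> fiber R S M" "card F = 3" by blast
    from F(2) obtain P Q N where "F = {P, Q, N}" "P \<noteq> Q" "P \<noteq> N" "Q \<noteq> N"
      unfolding card_3_iff by blast
    then show False
      using no_three_primes_in_fiber[OF assms(2,4,5), of P M Q N] F(1) by simp
  qed
qed

end
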